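(* Let $n\ge 1$, let $H$ be a group and let $h\in H$ with $h\ne 1$. Let $H_1,\dots,H_n$ be $n$ copies of $H$, with natural isomorphisms $\phi_i:H\to H_i$, let $G=H_1*\dots*H_n$ be their free product, and put $h_i=\phi_i(h)\in H_i\subset G$. For $k=1,\dots,n-1$ let $\tau_k:G\to G$ be the automorphism determined, for all $y\in H$, by $$\tau_k(\phi_k(y))=h_k^{-1}\,\phi_{k+1}(y)\,h_k,\qquad \tau_k(\phi_{k+1}(y))=h_k\,\phi_k(y)\,h_k^{-1},\qquad \tau_k(\phi_j(y))=\phi_j(y)\ \text{ if } j\ne k,k+1 .$$ Then the mapping $\sigma_k\mapsto\tau_k$, $k=1,\dots,n-1$, determines a representation (group homomorphism) $\rho:B_n\to\mathrm{Aut}(G)$, where $B_n$ is the braid group on $n$ strands with standard generators $\sigma_1,\dots,\sigma_{n-1}$.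
   Context: The braid group $B_n$ is the group with generators $\sigma_1,\dots,\sigma_{n-1}$ and relations $\sigma_i\sigma_{i+1}\sigma_i=\sigma_{i+1}\sigma_i\sigma_{i+1}$ for $1\le i\le n-2$ and $\sigma_i\sigma_j=\sigma_j\sigma_i$ for $|i-j|\ge 2$. The product in $\mathrm{Aut}(G)$ is composition of maps. *)

theory Defs
  imports "HOL-Algebra.Bij"
begin

section \<open>Monoids and groups given by generators and relations\<close>

text \<open>The least congruence on the free monoid of words over \<open>A\<close> that contains \<open>R\<close>.\<close>

inductive_set word_cong :: "'a set \<Rightarrow> ('a list \<times> 'a list) set \<Rightarrow> ('a list \<times> 'a list) set"
  for A R where
  base: "(u, v) \<in> R \<Longrightarrow> u \<in> lists A \<Longrightarrow> v \<in> lists A \<Longrightarrow> (u, v) \<in> word_cong A R"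
| refl: "u \<in> lists A \<Longrightarrow> (u, u) \<in> word_cong A R"
| sym: "(u, v) \<in> word_cong A R \<Longrightarrow> (v, u) \<in> word_cong A R"
| trans: "(u, v) \<in> word_cong A R \<Longrightarrow> (v, w) \<in> word_cong A R \<Longrightarrow> (u, w) \<in> word_cong A R"
| append: "(u, u') \<in> word_cong A R \<Longrightarrow> (v, v') \<in> word_cong A R \<Longrightarrow> (u @ v, u' @ v') \<in> word_cong A R"

definition presented_monoid :: "'a set \<Rightarrow> ('a list \<times> 'a list) set \<Rightarrow> 'a list set monoid"
  where "presented_monoid A R =
    \<lparr>carrier = lists A // word_cong A R,
     mult = (\<lambda>X Y. \<Union>u\<in>X. \<Union>v\<in>Y. word_cong A R `` {u @ v}),
     one = word_cong A R `` {[]}\<rparr>"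

text \<open>In group words, \<open>(s, True)\<close> stands for the generator \<open>s\<close> and \<open>(s, False)\<close> for its
  formal inverse.\<close>

definition group_relations ::
    "'s set \<Rightarrow> (('s \<times> bool) list \<times> ('s \<times> bool) list) set \<Rightarrow> (('s \<times> bool) list \<times> ('s \<times> bool) list) set"
  where "group_relations S R = R \<union> {([(s, b), (s, \<not> b)], []) | s b. s \<in> S}"

definition presented_group ::
    "'s set \<Rightarrow> (('s \<times> bool) list \<times> ('s \<times> bool) list) set \<Rightarrow> ('s \<times> bool) list set monoid"
  where "presented_group S R = presented_monoid (S \<times> UNIV) (group_relations S R)"

definition group_gen ::
    "'s set \<Rightarrow> (('s \<times> bool) list \<times> ('s \<times> bool) list) set \<Rightarrow> 's \<Rightarrow> ('s \<times> bool) list set"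
  where "group_gen S R s = word_cong (S \<times> UNIV) (group_relations S R) `` {[(s, True)]}"


section \<open>The braid group\<close>

definition braid_relations :: "nat \<Rightarrow> ((nat \<times> bool) list \<times> (nat \<times> bool) list) set"
  where "braid_relations n =
    {([(i, True), (i + 1, True), (i, True)], [(i + 1, True), (i, True), (i + 1, True)]) | i.
        i \<in> {1..n - 2}} \<union>
    {([(i, True), (j, True)], [(j, True), (i, True)]) | i j.
        i \<in> {1..n - 1} \<and> j \<in> {1..n - 1} \<and> \<bar>int i - int j\<bar> \<ge> 2}"

definition braid_group :: "nat \<Rightarrow> (nat \<times> bool) list set monoid"
  where "braid_group n = presented_group {1..n - 1} (braid_relations n)"

definition braid_gen :: "nat \<Rightarrow> nat \<Rightarrow> (nat \<times> bool) list set"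
  where "braid_gen n k = group_gen {1..n - 1} (braid_relations n) k"


section \<open>Free products of groups\<close>

text \<open>The letters are the elements of the disjoint union of the factors; the relations multiply
  adjacent letters from the same factor and delete identity elements.\<close>

definition free_product_letters :: "'i set \<Rightarrow> ('i \<Rightarrow> ('g, 'm) monoid_scheme) \<Rightarrow> ('i \<times> 'g) set"
  where "free_product_letters I K = (SIGMA i:I. carrier (K i))"

definition free_product_relations ::
    "'i set \<Rightarrow> ('i \<Rightarrow> ('g, 'm) monoid_scheme) \<Rightarrow> (('i \<times> 'g) list \<times> ('i \<times> 'g) list) set"
  where "free_product_relations I K =
    {([(i, x), (i, y)], [(i, x \<otimes>\<^bsub>K i\<^esub> y)]) | i x y. i \<in> I \<and> x \<in> carrier (K i) \<and> y \<in> carrier (K i)} \<union>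
    {([(i, \<one>\<^bsub>K i\<^esub>)], []) | i. i \<in> I}"

definition free_product :: "'i set \<Rightarrow> ('i \<Rightarrow> ('g, 'm) monoid_scheme) \<Rightarrow> ('i \<times> 'g) list set monoid"
  where "free_product I K = presented_monoid (free_product_letters I K) (free_product_relations I K)"

definition free_factor ::
    "'i set \<Rightarrow> ('i \<Rightarrow> ('g, 'm) monoid_scheme) \<Rightarrow> 'i \<Rightarrow> 'g \<Rightarrow> ('i \<times> 'g) list set"
  where "free_factor I K i x =
    word_cong (free_product_letters I K) (free_product_relations I K) `` {[(i, x)]}"


section \<open>The automorphisms\<close>

text \<open>Here \<open>\<psi> i : H \<rightarrow> G\<close> is the isomorphism of \<open>H\<close> onto its \<open>i\<close>-th copy, followed by the
  embedding of that copy in \<open>G\<close>.\<close>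

definition is_twist_automorphism ::
    "('g, 'c) monoid_scheme \<Rightarrow> ('a, 'b) monoid_scheme \<Rightarrow> nat \<Rightarrow> (nat \<Rightarrow> 'a \<Rightarrow> 'g) \<Rightarrow> 'a \<Rightarrow> nat \<Rightarrow> ('g \<Rightarrow> 'g) \<Rightarrow> bool"
  where "is_twist_automorphism G H n \<psi> h k t \<longleftrightarrow>
    t \<in> auto G \<and>
    (\<forall>y\<in>carrier H.
      t (\<psi> k y) = inv\<^bsub>G\<^esub> (\<psi> k h) \<otimes>\<^bsub>G\<^esub> \<psi> (k + 1) y \<otimes>\<^bsub>G\<^esub> \<psi> k h \<and>
      t (\<psi> (k + 1) y) = \<psi> k h \<otimes>\<^bsub>G\<^esub> \<psi> k y \<otimes>\<^bsub>G\<^esub> inv\<^bsub>G\<^esub> (\<psi> k h) \<and>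
      (\<forall>j\<in>{1..n}. j \<noteq> k \<and> j \<noteq> k + 1 \<longrightarrow> t (\<psi> j y) = \<psi> j y))"


section \<open>Basic properties of the constructions\<close>

lemma word_cong_lists: "(u, v) \<in> word_cong A R \<Longrightarrow> u \<in> lists A \<and> v \<in> lists A"
  by (induction rule: word_cong.induct) auto

lemma equiv_word_cong: "equiv (lists A) (word_cong A R)"
proof (rule equivI)
  show "word_cong A R \<subseteq> lists A \<times> lists A" by (meson SigmaI subrelI word_cong_lists)
  show "refl_on (lists A) (word_cong A R)" by (simp add: refl_on_def word_cong.refl del: in_lists_conv_set)
  show "sym_on UNIV (word_cong A R)" by (auto intro: symI word_cong.sym)
  show "trans_on UNIV (word_cong A R)" by (auto intro: transI word_cong.trans)
qed

lemma word_class_eq_iff: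
  "u \<in> lists A \<Longrightarrow> v \<in> lists A \<Longrightarrow>
    word_cong A R `` {u} = word_cong A R `` {v} \<longleftrightarrow> (u, v) \<in> word_cong A R"
  using eq_equiv_class_iff[OF equiv_word_cong] .

lemma presented_monoid_mult:
  assumes "u \<in> lists A" "v \<in> lists A"
  shows "word_cong A R `` {u} \<otimes>\<^bsub>presented_monoid A R\<^esub> word_cong A R `` {v} = word_cong A R `` {u @ v}"
proof -
  have "congruent2 (word_cong A R) (word_cong A R) (\<lambda>u v. word_cong A R `` {u @ v})"
    by (intro congruent2I' equiv_class_eq[OF equiv_word_cong] word_cong.append)
  from UN_equiv_class2[OF equiv_word_cong equiv_word_cong this assms]
  show ?thesis by (simp add: presented_monoid_def)
qed

lemma presented_monoid_one: "\<one>\<^bsub>presented_monoid A R\<^esub> = word_cong A R `` {[]}"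
  by (simp add: presented_monoid_def)

lemma presented_monoid_class [intro]:
  "u \<in> lists A \<Longrightarrow> word_cong A R `` {u} \<in> carrier (presented_monoid A R)"
  by (simp add: presented_monoid_def quotientI)

lemma presented_monoid_cases:
  assumes "X \<in> carrier (presented_monoid A R)"
  obtains u where "u \<in> lists A" "X = word_cong A R `` {u}"
proof -
  have "X \<in> lists A // word_cong A R" using assms by (simp add: presented_monoid_def)
  then show thesis by (rule quotientE) (rule that)
qed

lemma monoid_presented_monoid: "monoid (presented_monoid A R)"
proof
  fix x y z
  assume x: "x \<in> carrier (presented_monoid A R)" and y: "y \<in> carrier (presented_monoid A R)"
  obtain u v where uv: "u \<in> lists A" "x = word_cong A R `` {u}" "v \<in> lists A" "y = word_cong A R `` {v}"
    by (metis x y presented_monoid_cases)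
  then show "x \<otimes>\<^bsub>presented_monoid A R\<^esub> y \<in> carrier (presented_monoid A R)"
    by (metis presented_monoid_class presented_monoid_mult append_in_lists_conv)
  assume z: "z \<in> carrier (presented_monoid A R)"
  obtain w where w: "w \<in> lists A" "z = word_cong A R `` {w}"
    by (metis z presented_monoid_cases)
  show "x \<otimes>\<^bsub>presented_monoid A R\<^esub> y \<otimes>\<^bsub>presented_monoid A R\<^esub> z =
        x \<otimes>\<^bsub>presented_monoid A R\<^esub> (y \<otimes>\<^bsub>presented_monoid A R\<^esub> z)"
    using uv w by (simp add: presented_monoid_mult)
next
  fix x assume "x \<in> carrier (presented_monoid A R)"
  then obtain u where u: "u \<in> lists A" "x = word_cong A R `` {u}"
    by (metis presented_monoid_cases)
  show "\<one>\<^bsub>presented_monoid A R\<^esub> \<otimes>\<^bsub>presented_monoid A R\<^esub> x = x"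
    and "x \<otimes>\<^bsub>presented_monoid A R\<^esub> \<one>\<^bsub>presented_monoid A R\<^esub> = x"
    using u by (simp_all add: presented_monoid_one presented_monoid_mult)
next
  show "\<one>\<^bsub>presented_monoid A R\<^esub> \<in> carrier (presented_monoid A R)"
    by (auto simp: presented_monoid_one)
qed

lemma group_presented_monoid:
  assumes inv: "\<And>a. a \<in> A \<Longrightarrow> \<exists>b\<in>A. ([b, a], []) \<in> word_cong A R"
  shows "group (presented_monoid A R)"
proof -
  interpret monoid "presented_monoid A R" by (rule monoid_presented_monoid)
  have left: "\<exists>v\<in>lists A. (v @ u, []) \<in> word_cong A R" if "u \<in> lists A" for u
    using that
  proof (induction rule: lists.induct)
    case Nil
    then show ?case by (auto intro: word_cong.refl)
  next
    case (Cons a u)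
    from Cons.IH obtain v where v: "v \<in> lists A" "(v @ u, []) \<in> word_cong A R" by blast
    from Cons.hyps obtain b where b: "b \<in> A" "([b, a], []) \<in> word_cong A R"
      using inv by blast
    have "((v @ [b, a]) @ u, (v @ []) @ u) \<in> word_cong A R"
      using v b Cons.hyps by (intro word_cong.append word_cong.refl) auto
    then have "((v @ [b]) @ a # u, v @ u) \<in> word_cong A R" by simp
    then have "((v @ [b]) @ a # u, []) \<in> word_cong A R"
      using v(2) by (rule word_cong.trans)
    then show ?case using v b by (intro bexI[of _ "v @ [b]"]) auto
  qed
  show ?thesis
  proof (rule groupI)
    fix x assume "x \<in> carrier (presented_monoid A R)"
    then obtain u where u: "u \<in> lists A" "x = word_cong A R `` {u}"
      by (metis presented_monoid_cases)
    with left obtain v where v: "v \<in> lists A" "(v @ u, []) \<in> word_cong A R" by blast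
    show "\<exists>y\<in>carrier (presented_monoid A R). y \<otimes>\<^bsub>presented_monoid A R\<^esub> x = \<one>\<^bsub>presented_monoid A R\<^esub>"
      using u v
      by (intro bexI[of _ "word_cong A R `` {v}"])
        (auto simp: presented_monoid_mult presented_monoid_one word_class_eq_iff)
  qed (simp_all add: m_assoc)
qed

lemma group_presented_group: "group (presented_group S R)"
  unfolding presented_group_def
proof (rule group_presented_monoid)
  fix a :: "'a \<times> bool" assume a: "a \<in> S \<times> UNIV"
  have "([(fst a, \<not> snd a), a], []) \<in> group_relations S R"
    using a by (cases a) (simp add: group_relations_def)
  then have "([(fst a, \<not> snd a), a], []) \<in> word_cong (S \<times> UNIV) (group_relations S R)"
    using a by (intro word_cong.base) auto
  then show "\<exists>b\<in>S \<times> UNIV. ([b, a], []) \<in> word_cong (S \<times> UNIV) (group_relations S R)"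
    using a by auto
qed

lemma group_braid_group: "group (braid_group n)"
  unfolding braid_group_def by (rule group_presented_group)

lemma group_free_product:
  assumes "\<And>i. i \<in> I \<Longrightarrow> group (K i)"
  shows "group (free_product I K)"
  unfolding free_product_def
proof (rule group_presented_monoid)
  let ?A = "free_product_letters I K" and ?R = "free_product_relations I K"
  fix a assume "a \<in> ?A"
  then obtain i x where a: "a = (i, x)" "i \<in> I" "x \<in> carrier (K i)"
    by (auto simp: free_product_letters_def)
  interpret group "K i" using assms a by simp
  have "([(i, inv\<^bsub>K i\<^esub> x), (i, x)], [(i, inv\<^bsub>K i\<^esub> x \<otimes>\<^bsub>K i\<^esub> x)]) \<in> ?R"
    using a unfolding free_product_relations_def by blast
  then have "([(i, inv\<^bsub>K i\<^esub> x), a], [(i, \<one>\<^bsub>K i\<^esub>)]) \<in> word_cong ?A ?R"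
    using a by (intro word_cong.base) (auto simp: free_product_letters_def)
  moreover have "([(i, \<one>\<^bsub>K i\<^esub>)], []) \<in> word_cong ?A ?R"
    using a by (intro word_cong.base) (auto simp: free_product_letters_def free_product_relations_def)
  ultimately have "([(i, inv\<^bsub>K i\<^esub> x), a], []) \<in> word_cong ?A ?R"
    by (rule word_cong.trans)
  then show "\<exists>b\<in>?A. ([b, a], []) \<in> word_cong ?A ?R"
    using a by (intro bexI[of _ "(i, inv\<^bsub>K i\<^esub> x)"]) (auto simp: free_product_letters_def)
qed

lemma hom_free_factor:
  assumes "i \<in> I" "monoid (K i)"
  shows "free_factor I K i \<in> hom (K i) (free_product I K)"
proof (rule homI)
  let ?A = "free_product_letters I K" and ?R = "free_product_relations I K"
  interpret monoid "K i" by fact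
  fix x y assume x: "x \<in> carrier (K i)"
  then show "free_factor I K i x \<in> carrier (free_product I K)"
    using assms by (auto simp: free_factor_def free_product_def free_product_letters_def)
  assume y: "y \<in> carrier (K i)"
  have "([(i, x), (i, y)], [(i, x \<otimes>\<^bsub>K i\<^esub> y)]) \<in> ?R"
    using x y assms unfolding free_product_relations_def by blast
  then have "([(i, x), (i, y)], [(i, x \<otimes>\<^bsub>K i\<^esub> y)]) \<in> word_cong ?A ?R"
    using x y assms by (intro word_cong.base) (auto simp: free_product_letters_def)
  then show "free_factor I K i (x \<otimes>\<^bsub>K i\<^esub> y) =
      free_factor I K i x \<otimes>\<^bsub>free_product I K\<^esub> free_factor I K i y"
    using x y assms
    by (simp add: free_factor_def free_product_def presented_monoid_mult free_product_letters_def
        word_class_eq_iff word_cong.sym)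
qed


section \<open>Universal properties\<close>

definition word_eval :: "('k, 'm) monoid_scheme \<Rightarrow> ('a \<Rightarrow> 'k) \<Rightarrow> 'a list \<Rightarrow> 'k"
  where "word_eval L f u = foldr (\<lambda>a x. f a \<otimes>\<^bsub>L\<^esub> x) u \<one>\<^bsub>L\<^esub>"

lemma presented_monoid_universal:
  assumes L: "monoid L" and f: "f \<in> A \<rightarrow> carrier L"
    and R: "\<And>u v. (u, v) \<in> R \<Longrightarrow> u \<in> lists A \<Longrightarrow> v \<in> lists A \<Longrightarrow> word_eval L f u = word_eval L f v"
  shows "\<exists>!F. F \<in> extensional (carrier (presented_monoid A R)) \<and>
    F \<in> hom (presented_monoid A R) L \<and> F \<one>\<^bsub>presented_monoid A R\<^esub> = \<one>\<^bsub>L\<^esub> \<and>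
    (\<forall>a\<in>A. F (word_cong A R `` {[a]}) = f a)"
proof (rule ex_ex1I)
  interpret monoid L by fact
  let ?P = "presented_monoid A R" and ?cl = "\<lambda>u. word_cong A R `` {u}"
  have cl: "word_eval L f u \<in> carrier L" if "u \<in> lists A" for u
    using that f by (induction u) (auto simp: word_eval_def)
  have app: "word_eval L f (u @ v) = word_eval L f u \<otimes>\<^bsub>L\<^esub> word_eval L f v"
    if "u \<in> lists A" "v \<in> lists A" for u v
    using that
  proof (induction u)
    case Nil
    then show ?case using cl[of v] by (simp add: word_eval_def)
  next
    case (Cons a u)
    then have "f a \<in> carrier L" using f by auto
    then show ?case using Cons cl[of u] cl[of v] by (simp add: word_eval_def m_assoc)
  qed
  have cong: "word_eval L f u = word_eval L f v" if "(u, v) \<in> word_cong A R" for u v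
    using that
  proof induction
    case (append u u' v v')
    then show ?case
      using app word_cong_lists[of u u' A R] word_cong_lists[of v v' A R] by presburger
  qed (blast intro: R, simp_all)
  define F where "F = (\<lambda>X\<in>carrier ?P. the_elem (word_eval L f ` X))"
  have F: "F (?cl u) = word_eval L f u" if "u \<in> lists A" for u
  proof -
    have "u \<in> ?cl u" using word_cong.refl[OF that] by simp
    moreover have "word_eval L f v = word_eval L f u" if "v \<in> ?cl u" for v
      using cong[of u v] that by simp
    ultimately have "word_eval L f ` ?cl u = {word_eval L f u}" by blast
    then show ?thesis using that by (simp add: F_def presented_monoid_class)
  qed
  have "F \<in> hom ?P L"
  proof (rule homI)
    fix x y assume x: "x \<in> carrier ?P"
    then obtain u where u: "u \<in> lists A" "x = ?cl u" by (metis presented_monoid_cases)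
    then show "F x \<in> carrier L" by (simp add: F cl)
    assume "y \<in> carrier ?P"
    then obtain v where v: "v \<in> lists A" "y = ?cl v" by (metis presented_monoid_cases)
    then show "F (x \<otimes>\<^bsub>?P\<^esub> y) = F x \<otimes>\<^bsub>L\<^esub> F y"
      using u by (simp add: presented_monoid_mult F app)
  qed
  moreover have "F (?cl [a]) = f a" if "a \<in> A" for a
    using that F[of "[a]"] funcset_mem[OF f that] by (simp add: word_eval_def)
  ultimately show "\<exists>F. F \<in> extensional (carrier ?P) \<and> F \<in> hom ?P L \<and> F \<one>\<^bsub>?P\<^esub> = \<one>\<^bsub>L\<^esub> \<and>
      (\<forall>a\<in>A. F (?cl [a]) = f a)"
    using F[of "[]"]
    by (intro exI[of _ F]) (auto simp: presented_monoid_one word_eval_def F_def)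
next
  let ?P = "presented_monoid A R" and ?cl = "\<lambda>u. word_cong A R `` {u}"
  have det: "F (?cl u) = word_eval L f u"
    if "F \<in> hom ?P L" "F \<one>\<^bsub>?P\<^esub> = \<one>\<^bsub>L\<^esub>" "\<forall>a\<in>A. F (?cl [a]) = f a" "u \<in> lists A" for F u
    using that(4)
  proof (induction u)
    case Nil
    then show ?case using that by (simp add: presented_monoid_one word_eval_def)
  next
    case (Cons a u)
    then have "?cl (a # u) = ?cl [a] \<otimes>\<^bsub>?P\<^esub> ?cl u" by (simp add: presented_monoid_mult)
    then have "F (?cl (a # u)) = F (?cl [a]) \<otimes>\<^bsub>L\<^esub> F (?cl u)"
      using Cons that(1) by (simp add: hom_mult presented_monoid_class)
    then show ?case using Cons that by (simp add: word_eval_def)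
  qed
  fix F F'
  assume F: "F \<in> extensional (carrier ?P) \<and> F \<in> hom ?P L \<and> F \<one>\<^bsub>?P\<^esub> = \<one>\<^bsub>L\<^esub> \<and> (\<forall>a\<in>A. F (?cl [a]) = f a)"
    and F': "F' \<in> extensional (carrier ?P) \<and> F' \<in> hom ?P L \<and> F' \<one>\<^bsub>?P\<^esub> = \<one>\<^bsub>L\<^esub> \<and> (\<forall>a\<in>A. F' (?cl [a]) = f a)"
  show "F = F'"
  proof (rule extensionalityI)
    fix x assume "x \<in> carrier ?P"
    then obtain u where "u \<in> lists A" "x = ?cl u" by (metis presented_monoid_cases)
    then show "F x = F' x" using F F' det by metis
  qed (use F F' in auto)
qed

lemma free_product_universal:
  assumes K: "\<And>i. i \<in> I \<Longrightarrow> group (K i)" and L: "group L"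
    and f: "\<And>i. i \<in> I \<Longrightarrow> f i \<in> hom (K i) L"
  shows "\<exists>!F. F \<in> extensional (carrier (free_product I K)) \<and> F \<in> hom (free_product I K) L \<and>
    (\<forall>i\<in>I. \<forall>x\<in>carrier (K i). F (free_factor I K i x) = f i x)"
proof -
  let ?A = "free_product_letters I K" and ?R = "free_product_relations I K"
  interpret L: group L by fact
  have one: "f i \<one>\<^bsub>K i\<^esub> = \<one>\<^bsub>L\<^esub>" if "i \<in> I" for i
    using hom_one[OF f K L] that by simp
  have clo: "f i x \<in> carrier L" if "i \<in> I" "x \<in> carrier (K i)" for i x
    using f that by (meson hom_in_carrier)
  have "\<exists>!F. F \<in> extensional (carrier (presented_monoid ?A ?R)) \<and>
      F \<in> hom (presented_monoid ?A ?R) L \<and> F \<one>\<^bsub>presented_monoid ?A ?R\<^esub> = \<one>\<^bsub>L\<^esub> \<and>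
      (\<forall>a\<in>?A. F (word_cong ?A ?R `` {[a]}) = (\<lambda>(i, x). f i x) a)"
  proof (rule presented_monoid_universal)
    fix u v assume "(u, v) \<in> ?R"
    then consider i x y where "i \<in> I" "x \<in> carrier (K i)" "y \<in> carrier (K i)"
        "u = [(i, x), (i, y)]" "v = [(i, x \<otimes>\<^bsub>K i\<^esub> y)]"
      | i where "i \<in> I" "u = [(i, \<one>\<^bsub>K i\<^esub>)]" "v = []"
      by (auto simp: free_product_relations_def)
    then show "word_eval L (\<lambda>(i, x). f i x) u = word_eval L (\<lambda>(i, x). f i x) v"
    proof cases
      case (1 i x y)
      then show ?thesis by (simp add: word_eval_def hom_mult[OF f] clo)
    next
      case (2 i)
      then show ?thesis by (simp add: word_eval_def one)
    qed
  qed (use clo in \<open>auto simp: free_product_letters_def L.is_monoid\<close>)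
  moreover have "F \<in> extensional (carrier (free_product I K)) \<and> F \<in> hom (free_product I K) L \<and>
      F \<one>\<^bsub>free_product I K\<^esub> = \<one>\<^bsub>L\<^esub> \<and> (\<forall>a\<in>?A. F (word_cong ?A ?R `` {[a]}) = (\<lambda>(i, x). f i x) a) \<longleftrightarrow>
      F \<in> extensional (carrier (free_product I K)) \<and> F \<in> hom (free_product I K) L \<and>
      (\<forall>i\<in>I. \<forall>x\<in>carrier (K i). F (free_factor I K i x) = f i x)" for F
    using hom_one[of F "free_product I K" L] group_free_product[of I K] K L
    unfolding free_factor_def free_product_letters_def by auto
  ultimately show ?thesis by (simp add: free_product_def)
qed

lemma presented_group_universal:
  assumes L: "group L" and f: "f \<in> S \<rightarrow> carrier L"
    and R: "\<And>u v. (u, v) \<in> R \<Longrightarrow> u \<in> lists (S \<times> UNIV) \<Longrightarrow> v \<in> lists (S \<times> UNIV) \<Longrightarrow>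
      word_eval L (\<lambda>(s, b). if b then f s else inv\<^bsub>L\<^esub> f s) u =
      word_eval L (\<lambda>(s, b). if b then f s else inv\<^bsub>L\<^esub> f s) v"
  shows "\<exists>!F. F \<in> extensional (carrier (presented_group S R)) \<and> F \<in> hom (presented_group S R) L \<and>
    (\<forall>s\<in>S. F (group_gen S R s) = f s)"
proof -
  let ?A = "S \<times> (UNIV :: bool set)" and ?R = "group_relations S R"
  let ?f = "\<lambda>(s, b). if b then f s else inv\<^bsub>L\<^esub> f s"
  let ?P = "presented_monoid ?A ?R" and ?cl = "\<lambda>u. word_cong ?A ?R `` {u}"
  interpret L: group L by fact
  interpret P: group ?P using group_presented_group[of S R] by (simp add: presented_group_def)
  have ex1: "\<exists>!F. F \<in> extensional (carrier ?P) \<and> F \<in> hom ?P L \<and> F \<one>\<^bsub>?P\<^esub> = \<one>\<^bsub>L\<^esub> \<and>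
      (\<forall>a\<in>?A. F (?cl [a]) = ?f a)"
  proof (rule presented_monoid_universal)
    fix u v assume "(u, v) \<in> ?R" and uv: "u \<in> lists ?A" "v \<in> lists ?A"
    then consider "(u, v) \<in> R" | s b where "s \<in> S" "u = [(s, b), (s, \<not> b)]" "v = []"
      by (auto simp: group_relations_def)
    then show "word_eval L ?f u = word_eval L ?f v"
    proof cases
      case 1
      then show ?thesis using R uv by blast
    next
      case 2
      then have "f s \<in> carrier L" using f by auto
      then show ?thesis using 2 by (cases b) (auto simp: word_eval_def)
    qed
  qed (use f in \<open>auto simp: L.is_monoid Pi_iff\<close>)
  have inv: "F (?cl [(s, False)]) = inv\<^bsub>L\<^esub> F (?cl [(s, True)])" if F: "F \<in> hom ?P L" and s: "s \<in> S" for F s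
  proof -
    interpret group_hom ?P L F using F by unfold_locales auto
    have "([(s, False), (s, True)], []) \<in> ?R"
      using s by (simp add: group_relations_def ex_bool_eq)
    then have "([(s, False), (s, True)], []) \<in> word_cong ?A ?R"
      using s by (intro word_cong.base) auto
    then have "?cl [(s, False)] \<otimes>\<^bsub>?P\<^esub> ?cl [(s, True)] = \<one>\<^bsub>?P\<^esub>"
      using s by (simp add: presented_monoid_mult presented_monoid_one word_class_eq_iff)
    then have "?cl [(s, False)] = inv\<^bsub>?P\<^esub> ?cl [(s, True)]"
      using s by (intro P.inv_equality[symmetric]) auto
    then show ?thesis using s by (simp add: presented_monoid_class)
  qed
  have "F \<in> extensional (carrier ?P) \<and> F \<in> hom ?P L \<and> F \<one>\<^bsub>?P\<^esub> = \<one>\<^bsub>L\<^esub> \<and> (\<forall>a\<in>?A. F (?cl [a]) = ?f a) \<longleftrightarrow>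
      F \<in> extensional (carrier ?P) \<and> F \<in> hom ?P L \<and> (\<forall>s\<in>S. F (?cl [(s, True)]) = f s)" for F
    using inv[of F] hom_one[of F ?P L] P.is_group L by (auto split: if_splits)
  with ex1 show ?thesis by (simp add: presented_group_def group_gen_def)
qed

end

theory Submission
  imports Defs
begin

text \<open>Each \<open>\<tau>\<^sub>k\<close> sends \<open>h\<^sub>k\<^sub>+\<^sub>1\<close> to \<open>h\<^sub>k\<close> and \<open>h\<^sub>k\<close> to
  \<open>h\<^sub>k\<inverse> h\<^sub>k\<^sub>+\<^sub>1 h\<^sub>k\<close>, so its inverse is the endomorphism of the same shape that conjugates by
  \<open>h\<^sub>k\<^sub>+\<^sub>1\<close> in place of \<open>h\<^sub>k\<close>. An endomorphism of a free product is determined by its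
  restrictions to the factors, so the braid relations need only be compared on each factor.\<close>

section \<open>Groups, bijections and automorphism groups\<close>

lemma (in group) inv_cancel_left:
  assumes "x \<in> carrier G" "y \<in> carrier G"
  shows "x \<otimes> (inv x \<otimes> y) = y" and "inv x \<otimes> (x \<otimes> y) = y"
  using assms by (simp_all flip: m_assoc)

lemma (in group) hom_conj:
  assumes "f \<in> hom H G" "c \<in> carrier G"
  shows "(\<lambda>y. c \<otimes> f y \<otimes> inv c) \<in> hom H G"
proof (rule homI)
  have cl: "f y \<in> carrier G" if "y \<in> carrier H" for y
    using assms(1) that by (rule hom_in_carrier)
  then show "c \<otimes> f y \<otimes> inv c \<in> carrier G" if "y \<in> carrier H" for y
    using assms(2) that by simp
  show "c \<otimes> f (y \<otimes>\<^bsub>H\<^esub> z) \<otimes> inv c = c \<otimes> f y \<otimes> inv c \<otimes> (c \<otimes> f z \<otimes> inv c)"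
    if "y \<in> carrier H" "z \<in> carrier H" for y z
    using assms that by (simp add: hom_mult[OF assms(1)] cl m_assoc inv_cancel_left)
qed

lemma BijI:
  assumes "f \<in> extensional S" "f \<in> S \<rightarrow> S" "g \<in> S \<rightarrow> S"
    and "\<And>x. x \<in> S \<Longrightarrow> g (f x) = x" "\<And>x. x \<in> S \<Longrightarrow> f (g x) = x"
  shows "f \<in> Bij S"
  using assms by (auto simp: Bij_def intro!: bij_betwI[of f S S g])

lemma AutoGroup_mult:
  assumes "group G" "s \<in> auto G" "t \<in> auto G"
  shows "s \<otimes>\<^bsub>AutoGroup G\<^esub> t = compose (carrier G) s t"
  using assms by (simp add: AutoGroup_def BijGroup_def auto_def)

text \<open>The universal property is only required for the target \<open>G\<close> itself, because quantifying over
  all target groups would need a polymorphic locale assumption.\<close>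

locale free_copies = group G for G (structure) +
  fixes H :: "('a, 'c) monoid_scheme" and n :: nat and \<psi> :: "nat \<Rightarrow> 'a \<Rightarrow> 'b" and h :: 'a
  assumes h: "h \<in> carrier H"
    and psi: "i \<in> {1..n} \<Longrightarrow> \<psi> i \<in> hom H G"
    and endo_ex1: "(\<And>i. i \<in> {1..n} \<Longrightarrow> f i \<in> hom H G) \<Longrightarrow>
      \<exists>!F. F \<in> extensional (carrier G) \<and> F \<in> hom G G \<and>
        (\<forall>i\<in>{1..n}. \<forall>y\<in>carrier H. F (\<psi> i y) = f i y)"
begin

section \<open>Endomorphisms prescribed on the factors\<close>

lemma psi_closed [simp]: "1 \<le> i \<Longrightarrow> i \<le> n \<Longrightarrow> y \<in> carrier H \<Longrightarrow> \<psi> i y \<in> carrier G"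
  using hom_in_carrier[OF psi, of i y] by simp

lemma psi_hom_comp: "F \<in> hom G G \<Longrightarrow> i \<in> {1..n} \<Longrightarrow> (\<lambda>y. F (\<psi> i y)) \<in> hom H G"
  using Group.hom_compose[OF psi, of i F G] by (simp add: comp_def)

text \<open>Both maps solve the extension problem posed by the restrictions of \<open>F\<close>, and
  that problem has only one solution.\<close>

lemma endo_eqI:
  assumes "F \<in> hom G G" "F' \<in> hom G G" "F \<in> extensional (carrier G)" "F' \<in> extensional (carrier G)"
    and "\<And>i y. 1 \<le> i \<Longrightarrow> i \<le> n \<Longrightarrow> y \<in> carrier H \<Longrightarrow> F (\<psi> i y) = F' (\<psi> i y)"
  shows "F = F'"
proof -
  let ?P = "\<lambda>E. E \<in> extensional (carrier G) \<and> E \<in> hom G G \<and>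
    (\<forall>i\<in>{1..n}. \<forall>y\<in>carrier H. E (\<psi> i y) = F (\<psi> i y))"
  have "\<exists>!E. ?P E"
    by (rule endo_ex1) (rule psi_hom_comp[OF assms(1)])
  then obtain E where E: "\<And>E'. ?P E' \<Longrightarrow> E' = E" by (rule ex1E) blast
  have "F = E" "F' = E" using assms by (auto intro!: E)
  then show ?thesis by simp
qed

lemma endo_compose:
  assumes "F \<in> hom G G" "F' \<in> hom G G"
  shows "compose (carrier G) F F' \<in> hom G G"
  using hom_compose[OF assms(2,1)] .

lemma endo_apply:
  assumes "F \<in> hom G G"
  shows "x \<in> carrier G \<Longrightarrow> y \<in> carrier G \<Longrightarrow> F (x \<otimes> y) = F x \<otimes> F y"
    and "x \<in> carrier G \<Longrightarrow> F (inv x) = inv F x"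
    and "x \<in> carrier G \<Longrightarrow> F x \<in> carrier G"
proof -
  interpret F: group_hom G G F using assms by unfold_locales
  show "x \<in> carrier G \<Longrightarrow> y \<in> carrier G \<Longrightarrow> F (x \<otimes> y) = F x \<otimes> F y"
    "x \<in> carrier G \<Longrightarrow> F (inv x) = inv F x" "x \<in> carrier G \<Longrightarrow> F x \<in> carrier G"
    by simp_all
qed

text \<open>The map exchanging the factors \<open>k\<close> and \<open>k + 1\<close> up to conjugation by \<open>c\<close>: \<open>\<tau>\<^sub>k\<close> is the case
  \<open>c = \<psi> k h\<close>, and its inverse the case \<open>c = \<psi> (k + 1) h\<close>.\<close>

definition swap_img :: "nat \<Rightarrow> 'b \<Rightarrow> nat \<Rightarrow> 'a \<Rightarrow> 'b" where
  "swap_img k c j y =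
    (if j = k then inv c \<otimes> \<psi> (k + 1) y \<otimes> c
     else if j = k + 1 then c \<otimes> \<psi> k y \<otimes> inv c
     else \<psi> j y)"

text \<open>The description is proper for \<open>1 \<le> k\<close>, \<open>k < n\<close> and
  \<open>c\<close> in the carrier, by \<open>endo_ex1\<close> and
  \<open>swap_img_hom\<close>.\<close>

definition swap :: "nat \<Rightarrow> 'b \<Rightarrow> 'b \<Rightarrow> 'b" where
  "swap k c = (THE F. F \<in> extensional (carrier G) \<and> F \<in> hom G G \<and>
    (\<forall>i\<in>{1..n}. \<forall>y\<in>carrier H. F (\<psi> i y) = swap_img k c i y))"

abbreviation twist :: "nat \<Rightarrow> 'b \<Rightarrow> 'b" where
  "twist k \<equiv> swap k (\<psi> k h)"

lemma swap_img_hom: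
  assumes "1 \<le> k" "k < n" "c \<in> carrier G" "i \<in> {1..n}"
  shows "swap_img k c i \<in> hom H G"
proof -
  have "(\<lambda>y. inv c \<otimes> \<psi> (k + 1) y \<otimes> c) \<in> hom H G"
    \<comment> \<open>Conjugating by \<open>inv c\<close> leaves \<open>inv (inv c)\<close> on the
      right, which simplifies to \<open>c\<close>.\<close>
    using hom_conj[OF psi, of "k + 1" "inv c"] assms by simp
  moreover have "(\<lambda>y. c \<otimes> \<psi> k y \<otimes> inv c) \<in> hom H G"
    using assms by (intro hom_conj psi) auto
  ultimately show ?thesis
    using assms psi[of i] by (cases "i = k"; cases "i = k + 1") (simp_all add: swap_img_def[abs_def])
qed

lemma swap:
  assumes "1 \<le> k" "k < n" "c \<in> carrier G"
  shows "swap k c \<in> extensional (carrier G)" "swap k c \<in> hom G G"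
    and "\<And>i y. 1 \<le> i \<Longrightarrow> i \<le> n \<Longrightarrow> y \<in> carrier H \<Longrightarrow> swap k c (\<psi> i y) = swap_img k c i y"
  using theI'[OF endo_ex1[OF swap_img_hom[OF assms]]] unfolding swap_def by auto

lemmas endo_swap = endo_apply[OF swap(2)]

text \<open>These rules evaluate composites of swaps on a factor and reduce the resulting words to
  right-associated form with adjacent inverses cancelled.\<close>

lemmas twist_simps =
  compose_def swap swap_img_def endo_swap m_assoc inv_mult_group inv_cancel_left

section \<open>Invertibility and uniqueness of the twists\<close>

text \<open>The outer map turns the inner conjugation by \<open>d\<close> into one by
  \<open>c\<close>, which cancels its own conjugation on the exchanged factor.\<close>

lemma swap_comp_id:
  assumes "1 \<le> k" "k < n" "c \<in> carrier G" "d \<in> carrier G" "swap k c d = c" "x \<in> carrier G"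
  shows "swap k c (swap k d x) = x"
proof -
  have "compose (carrier G) (swap k c) (swap k d) = (\<lambda>x\<in>carrier G. x)"
  proof (rule endo_eqI)
    show "compose (carrier G) (swap k c) (swap k d) \<in> hom G G" "(\<lambda>x\<in>carrier G. x) \<in> hom G G"
      using assms id_in_auto by (auto intro!: endo_compose swap simp: auto_def)
    show "compose (carrier G) (swap k c) (swap k d) (\<psi> i y) = (\<lambda>x\<in>carrier G. x) (\<psi> i y)"
      if "1 \<le> i" "i \<le> n" "y \<in> carrier H" for i y
      using assms that by (simp add: twist_simps)
  qed simp_all
  with assms(6) show ?thesis by (metis compose_eq restrict_apply')
qed

lemma twist_auto:
  assumes "1 \<le> k" "k < n"
  shows "twist k \<in> auto G"
proof -
  let ?t = "twist k" and ?u = "swap k (\<psi> (k + 1) h)"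
  have cl: "\<psi> k h \<in> carrier G" "\<psi> (k + 1) h \<in> carrier G" using assms h by simp_all
  \<comment> \<open>An element commutes with itself, so \<open>?t\<close> sends
    \<open>\<psi> (k + 1) h\<close> to \<open>\<psi> k h\<close> and \<open>?u\<close> sends it
    back: \<open>swap_comp_id\<close> applies in both orders.\<close>
  have "?t (?u x) = x" "?u (?t x) = x" if "x \<in> carrier G" for x
    using assms cl h that
    by (auto intro!: swap_comp_id simp: swap swap_img_def m_assoc inv_cancel_left)
  then have "?t \<in> Bij (carrier G)"
    using assms cl by (intro BijI[where g = ?u]) (auto simp: swap endo_swap)
  then show ?thesis using assms cl by (simp add: auto_def swap)
qed

text \<open>The prescribed values cover every factor, so \<open>endo_eqI\<close> leaves a single
  candidate.\<close>

lemma is_twist_automorphism_iff: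
  assumes "1 \<le> k" "k < n"
  shows "is_twist_automorphism G H n \<psi> h k t \<longleftrightarrow> t = twist k"
proof
  have cl: "\<psi> k h \<in> carrier G" using assms h by simp
  assume t: "is_twist_automorphism G H n \<psi> h k t"
  show "t = twist k"
  proof (rule endo_eqI)
    show "t \<in> hom G G" "t \<in> extensional (carrier G)"
      using t by (auto simp: is_twist_automorphism_def auto_def Bij_def)
    show "t (\<psi> i y) = twist k (\<psi> i y)" if "1 \<le> i" "i \<le> n" "y \<in> carrier H" for i y
      using t assms cl that by (auto simp: is_twist_automorphism_def swap swap_img_def)
  qed (use assms cl in \<open>simp_all add: swap\<close>)
next
  assume "t = twist k"
  then show "is_twist_automorphism G H n \<psi> h k t"
    using assms h twist_auto[of k] by (auto simp: is_twist_automorphism_def swap swap_img_def)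
qed

section \<open>The braid relations and the representation\<close>

text \<open>The delicate factor is \<open>k\<close>: both sides conjugate
  \<open>\<psi> (k + 2) y\<close> by \<open>\<psi> (k + 1) h \<otimes> \<psi> k h\<close>, a product
  that \<open>twist k\<close> fixes.\<close>

lemma twist_braid:
  assumes "1 \<le> k" "k + 1 < n"
  shows "compose (carrier G) (twist k) (compose (carrier G) (twist (k + 1)) (twist k)) =
    compose (carrier G) (twist (k + 1)) (compose (carrier G) (twist k) (twist (k + 1)))"
proof (rule endo_eqI)
  fix i y assume i: "1 \<le> i" "i \<le> n" and y: "y \<in> carrier H"
  consider "i = k" | "i = k + 1" | "i = k + 2" | "i \<noteq> k" "i \<noteq> k + 1" "i \<noteq> k + 2" by blast
  then show "compose (carrier G) (twist k) (compose (carrier G) (twist (k + 1)) (twist k)) (\<psi> i y) =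
      compose (carrier G) (twist (k + 1)) (compose (carrier G) (twist k) (twist (k + 1))) (\<psi> i y)"
    using assms h i y by cases (simp_all add: twist_simps)
qed (use assms h in \<open>simp_all add: endo_compose swap\<close>)

text \<open>The pairs \<open>k\<close>, \<open>k + 1\<close> and \<open>l\<close>,
  \<open>l + 1\<close> are disjoint, so each twist fixes the factors and the conjugator of the
  other.\<close>

lemma twist_commute:
  assumes "1 \<le> k" "k < n" "1 \<le> l" "l < n" "\<bar>int k - int l\<bar> \<ge> 2"
  shows "compose (carrier G) (twist k) (twist l) = compose (carrier G) (twist l) (twist k)"
proof (rule endo_eqI)
  have kl: "k \<noteq> l" "k \<noteq> l + 1" "l \<noteq> k + 1" using assms by auto
  fix i y assume i: "1 \<le> i" "i \<le> n" and y: "y \<in> carrier H"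
  consider "i = k" | "i = k + 1" | "i = l" | "i = l + 1"
    | "i \<noteq> k" "i \<noteq> k + 1" "i \<noteq> l" "i \<noteq> l + 1" by blast
  then show "compose (carrier G) (twist k) (twist l) (\<psi> i y) =
      compose (carrier G) (twist l) (twist k) (\<psi> i y)"
    using assms(1-4) kl h i y by cases (simp_all add: twist_simps)
qed (use assms h in \<open>simp_all add: endo_compose swap\<close>)

lemma twist_representation:
  "\<exists>!\<rho>. \<rho> \<in> extensional (carrier (braid_group n)) \<and> group_hom (braid_group n) (AutoGroup G) \<rho> \<and>
    (\<forall>k\<in>{1..n - 1}. \<rho> (braid_gen n k) = twist k)"
proof -
  interpret A: group "AutoGroup G" by (rule AutoGroup)
  have carrier_A: "carrier (AutoGroup G) = auto G" by (simp add: AutoGroup_def)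
  have A_closed: "twist k \<in> carrier (AutoGroup G)" if "1 \<le> k" "k < n" for k
    using twist_auto that by (simp add: carrier_A)
  have mult: "s \<otimes>\<^bsub>AutoGroup G\<^esub> t = compose (carrier G) s t"
    if "s \<in> carrier (AutoGroup G)" "t \<in> carrier (AutoGroup G)" for s t
    using that AutoGroup_mult[OF is_group] by (simp add: carrier_A)
  have braid: "twist i \<otimes>\<^bsub>AutoGroup G\<^esub> (twist (i + 1) \<otimes>\<^bsub>AutoGroup G\<^esub> twist i) =
      twist (i + 1) \<otimes>\<^bsub>AutoGroup G\<^esub> (twist i \<otimes>\<^bsub>AutoGroup G\<^esub> twist (i + 1))" if "1 \<le> i" "i + 1 < n" for i
  proof -
    have "twist i \<in> carrier (AutoGroup G)" "twist (i + 1) \<in> carrier (AutoGroup G)"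
      using that by (auto intro!: A_closed)
    then show ?thesis using twist_braid[OF that] by (metis A.m_closed mult)
  qed
  have comm: "twist i \<otimes>\<^bsub>AutoGroup G\<^esub> twist j = twist j \<otimes>\<^bsub>AutoGroup G\<^esub> twist i"
    if "1 \<le> i" "i < n" "1 \<le> j" "j < n" "\<bar>int i - int j\<bar> \<ge> 2" for i j
    using twist_commute[OF that] that by (simp add: mult A_closed)
  have "\<exists>!F. F \<in> extensional (carrier (presented_group {1..n - 1} (braid_relations n))) \<and>
      F \<in> hom (presented_group {1..n - 1} (braid_relations n)) (AutoGroup G) \<and>
      (\<forall>s\<in>{1..n - 1}. F (group_gen {1..n - 1} (braid_relations n) s) = twist s)"
  proof (rule presented_group_universal)
    show "twist \<in> {1..n - 1} \<rightarrow> carrier (AutoGroup G)"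
      by (auto intro!: A_closed)
    fix u v assume "(u, v) \<in> braid_relations n"
    then consider
        i where "1 \<le> i" "i + 1 < n" "u = [(i, True), (i + 1, True), (i, True)]"
          "v = [(i + 1, True), (i, True), (i + 1, True)]"
      | i j where "1 \<le> i" "i < n" "1 \<le> j" "j < n" "\<bar>int i - int j\<bar> \<ge> 2"
          "u = [(i, True), (j, True)]" "v = [(j, True), (i, True)]"
      \<comment> \<open>Truncated subtraction is harmless: for \<open>n \<le> 2\<close> the interval
        \<open>{1..n - 2}\<close> is empty, matching \<open>i + 1 < n\<close>.\<close>
      unfolding braid_relations_def by fastforce
    then show "word_eval (AutoGroup G) (\<lambda>(s, b). if b then twist s else inv\<^bsub>AutoGroup G\<^esub> twist s) u =
        word_eval (AutoGroup G) (\<lambda>(s, b). if b then twist s else inv\<^bsub>AutoGroup G\<^esub> twist s) v"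
    proof cases
      case 1
      then show ?thesis using braid[of i] A_closed[of i] A_closed[of "i + 1"]
        by (simp add: word_eval_def)
    next
      case 2
      then show ?thesis using comm[of i j] by (simp add: word_eval_def A_closed)
    qed
  qed (rule A.is_group)
  moreover have "group_hom (braid_group n) (AutoGroup G) F \<longleftrightarrow> F \<in> hom (braid_group n) (AutoGroup G)" for F
    by (simp add: group_hom_def group_hom_axioms_def group_braid_group A.is_group)
  ultimately show ?thesis by (simp add: braid_group_def braid_gen_def)
qed

end

section \<open>Transport to the given copies of \<open>H\<close>\<close>

lemma free_copies_free_product:
  assumes H: "group H" "h \<in> carrier H"
    and K: "\<And>i. i \<in> {1..n} \<Longrightarrow> group (K i)"
    and \<phi>: "\<And>i. i \<in> {1..n} \<Longrightarrow> \<phi> i \<in> iso H (K i)"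
  shows "free_copies (free_product {1..n} K) H n (\<lambda>i y. free_factor {1..n} K i (\<phi> i y)) h"
proof -
  let ?G = "free_product {1..n} K"
  interpret group ?G using K by (rule group_free_product)
  show ?thesis
  proof
    show "(\<lambda>y. free_factor {1..n} K i (\<phi> i y)) \<in> hom H ?G" if "i \<in> {1..n}" for i
    proof -
      have "\<phi> i \<in> hom H (K i)" "free_factor {1..n} K i \<in> hom (K i) ?G"
        using \<phi> K that by (auto simp: iso_def group.is_monoid intro: hom_free_factor)
      from Group.hom_compose[OF this] show ?thesis by (simp add: comp_def)
    qed
    fix f assume f: "\<And>i. i \<in> {1..n} \<Longrightarrow> f i \<in> hom H ?G"
    \<comment> \<open>The universal property speaks of maps on \<open>K i\<close>, so
      \<open>f i\<close> is pulled back along the inverse of \<open>\<phi> i\<close>.\<close>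
    let ?g = "\<lambda>i. f i \<circ> inv_into (carrier H) (\<phi> i)"
    have bij: "bij_betw (\<phi> i) (carrier H) (carrier (K i))" if "i \<in> {1..n}" for i
      using \<phi>[OF that] by (simp add: iso_def)
    have g: "?g i \<in> hom (K i) ?G" if "i \<in> {1..n}" for i
      using group.iso_set_sym[OF H(1) \<phi>[OF that]] f[OF that]
      by (auto simp: iso_def intro: Group.hom_compose)
    have ex1: "\<exists>!F. F \<in> extensional (carrier ?G) \<and> F \<in> hom ?G ?G \<and>
      (\<forall>i\<in>{1..n}. \<forall>x\<in>carrier (K i). F (free_factor {1..n} K i x) = ?g i x)"
      by (rule free_product_universal[where f = ?g]) (use K g is_group in blast)+
    have restr: "(\<forall>i\<in>{1..n}. \<forall>x\<in>carrier (K i). F (free_factor {1..n} K i x) = ?g i x) \<longleftrightarrow>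
        (\<forall>i\<in>{1..n}. \<forall>y\<in>carrier H. F (free_factor {1..n} K i (\<phi> i y)) = f i y)" for F
    proof (rule ball_cong)
      fix i assume "i \<in> {1..n}"
      note bij = bij[OF this]
      show "(\<forall>x\<in>carrier (K i). F (free_factor {1..n} K i x) = ?g i x) \<longleftrightarrow>
          (\<forall>y\<in>carrier H. F (free_factor {1..n} K i (\<phi> i y)) = f i y)"
        \<comment> \<open>Writing \<open>carrier (K i)\<close> as the image of
          \<open>\<phi> i\<close> replaces each \<open>x\<close> by some \<open>\<phi> i y\<close>,
          on which the inverse cancels.\<close>
        unfolding bij_betw_imp_surj_on[OF bij, symmetric]
        by (simp add: bij_betw_inv_into_left[OF bij])
    qed simp
    from ex1 show "\<exists>!F. F \<in> extensional (carrier ?G) \<and> F \<in> hom ?G ?G \<and>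
      (\<forall>i\<in>{1..n}. \<forall>y\<in>carrier H. F (free_factor {1..n} K i (\<phi> i y)) = f i y)" unfolding restr .
  qed (rule H(2))
qed

theorem proposition1p1:
  fixes n :: nat
    and H :: "('a, 'b) monoid_scheme"
    and h :: 'a
    and Hs :: "nat \<Rightarrow> ('c, 'd) monoid_scheme"
    and \<phi> :: "nat \<Rightarrow> 'a \<Rightarrow> 'c"
  assumes "n \<ge> 1"
    and "group H"
    and "h \<in> carrier H"
    and "h \<noteq> \<one>\<^bsub>H\<^esub>"
    and "\<And>i. i \<in> {1..n} \<Longrightarrow> group (Hs i)"
    and "\<And>i. i \<in> {1..n} \<Longrightarrow> \<phi> i \<in> iso H (Hs i)"
  shows "let G = free_product {1..n} Hs;
             \<psi> = (\<lambda>i y. free_factor {1..n} Hs i (\<phi> i y))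
         in \<exists>\<tau>. (\<forall>k\<in>{1..n - 1}.
                    is_twist_automorphism G H n \<psi> h k (\<tau> k) \<and>
                    (\<forall>t. is_twist_automorphism G H n \<psi> h k t \<longrightarrow> t = \<tau> k)) \<and>
                (\<exists>!\<rho>. \<rho> \<in> extensional (carrier (braid_group n)) \<and>
                      group_hom (braid_group n) (AutoGroup G) \<rho> \<and>
                      (\<forall>k\<in>{1..n - 1}. \<rho> (braid_gen n k) = \<tau> k))"
proof -
  interpret free_copies "free_product {1..n} Hs" H n "\<lambda>i y. free_factor {1..n} Hs i (\<phi> i y)" h
    using assms(2,3,5,6) by (rule free_copies_free_product)
  have "is_twist_automorphism (free_product {1..n} Hs) H n
      (\<lambda>i y. free_factor {1..n} Hs i (\<phi> i y)) h k t \<longleftrightarrow> t = twist k" if "k \<in> {1..n - 1}" for k t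
    using is_twist_automorphism_iff[of k t] that by auto
  then show ?thesis
    \<comment> \<open>The family \<open>twist\<close> is the witness for
      \<open>\<tau>\<close>.\<close>
    unfolding Let_def by (intro exI[of _ twist] conjI ballI allI impI twist_representation) simp_all
qed

end
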